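(* If a graph property $\mathcal{P}$ has an oblivious one-sided error tester in the random neighbor oracle model, then $\mathcal{P}$ is uniformly semi-subgraph-free.
   Context: A graph property is a family of graphs closed under isomorphism; $\mathcal{P}_n$ is its restriction to $n$-vertex graphs; $G=(V,E)$ is $\varepsilon$-far from $\mathcal{P}_n$ if more than $\varepsilon|V|$ edge modifications are needed to reach $\mathcal{P}_n$. Random neighbor oracle: a query on $v$ returns a uniformly random neighbor of $v$, independently; uniformly random vertices can also be sampled. $\mathrm{Traverse}(G,v,q,q)$: $L_0=\{v\}$; for $j=1,\dots,q$, each $u\in L_{j-1}$ makes $q$ random neighbor queries obtaining $\Gamma_u$, recording edges $(u,x)$; $L_j$ is the union of the $\Gamma_u$ minus earlier levels; it returns the subgraph of recorded edges, rooted at $v$. A tester is oblivious if, given $\varepsilon$, it computes an integer $q=q(\varepsilon)$ (not depending on $n$), samples a multiset $S$ of $q$ uniformly random vertices, runs $\mathrm{Traverse}(G,v,q,q)$ from each $v\in S$ obtaining $U_v$, and accepts or rejects (possibly randomly) based only on $\varepsilon$ and the rooted graph $\bigcup_{v\in S}U_v$. One-sided error: inputs in $\mathcal{P}$ are always accepted, and inputs $\varepsilon$-far from $\mathcal{P}$ are rejected with probability at least $2/3$. $\mathcal{P}$ is uniformly semi-subgraph-free if for every $\varepsilon\in(0,1)$ there is a family $\mathcal{H}$ of graphs, depending only on $\mathcal{P}$ and $\varepsilon$ (not on $n$), with the number of members and their sizes bounded by a function of $\varepsilon$, such that every graph satisfying $\mathcal{P}$ contains no subgraph isomorphic to a member of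 $\mathcal{H}$, and every graph $\varepsilon$-far from $\mathcal{P}$ contains a subgraph isomorphic to some member of $\mathcal{H}$. *)

theory Defs
  imports "HOL-Probability.Product_PMF"
begin

text \<open>
  Every finite graph has an isomorphic copy with vertices in \<open>nat\<close>, so a family of finite graphs
  closed under isomorphism is represented by the set of its members of type \<open>graph\<close>.  Vertex sets
  are arbitrary finite nonempty subsets of \<open>nat\<close> (nonempty, since vertices have to be sampled).
\<close>

record graph =
  verts :: "nat set"
  edges :: "nat set set"

record rooted_graph = graph +
  roots :: "nat set"

definition simple_graph :: "graph \<Rightarrow> bool" where
  "simple_graph G \<longleftrightarrow>
     finite (verts G) \<and> verts G \<noteq> {} \<and> (\<forall>e\<in>edges G. e \<subseteq> verts G \<and> card e = 2)"

definition isomorphic :: "graph \<Rightarrow> graph \<Rightarrow> bool" where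
  "isomorphic G H \<longleftrightarrow>
     (\<exists>f. bij_betw f (verts G) (verts H) \<and> edges H = (\<lambda>e. f ` e) ` edges G)"

definition subgraph :: "graph \<Rightarrow> graph \<Rightarrow> bool" where
  "subgraph F G \<longleftrightarrow> simple_graph F \<and> verts F \<subseteq> verts G \<and> edges F \<subseteq> edges G"

definition graph_property :: "graph set \<Rightarrow> bool" where
  "graph_property P \<longleftrightarrow>
     (\<forall>G\<in>P. simple_graph G) \<and>
     (\<forall>G H. G \<in> P \<longrightarrow> simple_graph H \<longrightarrow> isomorphic G H \<longrightarrow> H \<in> P)"

definition edge_modifications :: "graph \<Rightarrow> graph \<Rightarrow> nat" where
  "edge_modifications G H = card ((edges G - edges H) \<union> (edges H - edges G))"

text \<open>
  Edge modifications keep the vertex set fixed.  If no graph on \<open>card (verts G)\<close> vertices has the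
  property, then \<open>G\<close> is far from it for every \<open>\<epsilon>\<close>.
\<close>

definition far_from :: "real \<Rightarrow> graph set \<Rightarrow> graph \<Rightarrow> bool" where
  "far_from \<epsilon> P G \<longleftrightarrow>
     (\<forall>H\<in>P. verts H = verts G \<longrightarrow> real (edge_modifications G H) > \<epsilon> * real (card (verts G)))"

definition neighbors :: "graph \<Rightarrow> nat \<Rightarrow> nat set" where
  "neighbors G u = {x. {u, x} \<in> edges G}"

text \<open>
  The set of answers to \<open>t\<close> independent random neighbor queries on \<open>u\<close>.  A query on an
  isolated vertex yields no neighbor.
\<close>

definition neighbor_queries :: "graph \<Rightarrow> nat \<Rightarrow> nat \<Rightarrow> nat set pmf" where
  "neighbor_queries G t u =
     (if neighbors G u = {} then return_pmf {}
      else map_pmf set (replicate_pmf t (pmf_of_set (neighbors G u))))"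

text \<open>
  The parameters \<open>A\<close>, \<open>L\<close> and \<open>R\<close> are the union of the earlier levels, the current level, and the
  edges recorded so far; the first parameter counts the remaining levels.  In \<open>Pi_pmf\<close>,
  the second argument is only the value of \<open>\<Gamma>\<close> outside \<open>L\<close>.
\<close>

primrec traverse_levels ::
  "nat \<Rightarrow> graph \<Rightarrow> nat \<Rightarrow> nat set \<Rightarrow> nat set \<Rightarrow> nat set set \<Rightarrow> nat set set pmf" where
  "traverse_levels 0 G t A L R = return_pmf R"
| "traverse_levels (Suc d) G t A L R = do {
     \<Gamma> \<leftarrow> Pi_pmf L {} (neighbor_queries G t);
     traverse_levels d G t (A \<union> L) ((\<Union>u\<in>L. \<Gamma> u) - (A \<union> L)) (R \<union> {{u, x} | u x. u \<in> L \<and> x \<in> \<Gamma> u})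
   }"

text \<open>
  The result of a traversal is the graph formed by the recorded edges.  If \<open>v\<close> is isolated, no edge
  is recorded and the result is empty.  Keeping \<open>v\<close> as an isolated root instead would tell the
  tester that \<open>v\<close> is isolated in the input.  The property of having no isolated vertices would then
  have an oblivious one-sided error tester, although it is not uniformly semi-subgraph-free: large
  edgeless graphs are far from it, but they embed into large perfect matchings.
\<close>

definition recorded_graph :: "nat \<Rightarrow> nat set set \<Rightarrow> rooted_graph" where
  "recorded_graph v R = \<lparr>verts = \<Union>R, edges = R, roots = {v} \<inter> \<Union>R\<rparr>"

definition traverse :: "graph \<Rightarrow> nat \<Rightarrow> nat \<Rightarrow> nat \<Rightarrow> rooted_graph pmf" where
  "traverse G v d t = map_pmf (recorded_graph v) (traverse_levels d G t {} {v} {})"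

definition union_graph :: "'i set \<Rightarrow> ('i \<Rightarrow> rooted_graph) \<Rightarrow> rooted_graph" where
  "union_graph I U =
     \<lparr>verts = (\<Union>i\<in>I. verts (U i)), edges = (\<Union>i\<in>I. edges (U i)), roots = (\<Union>i\<in>I. roots (U i))\<rparr>"

text \<open>
  The sampled multiset is \<open>{s 0, \<dots>, s (q - 1)}\<close>.  The second arguments of \<open>Pi_pmf\<close> are dummy
  values outside \<open>{..<q}\<close>.
\<close>

definition run_tester ::
  "nat \<Rightarrow> (rooted_graph \<Rightarrow> bool pmf) \<Rightarrow> graph \<Rightarrow> bool pmf" where
  "run_tester q decide G = do {
     s \<leftarrow> Pi_pmf {..<q} 0 (\<lambda>_. pmf_of_set (verts G));
     U \<leftarrow> Pi_pmf {..<q} (recorded_graph 0 {}) (\<lambda>i. traverse G (s i) q q);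
     decide (union_graph {..<q} U)
   }"

text \<open>
  The decision (\<open>True\<close> means accept) need not be invariant under isomorphism of rooted graphs,
  which admits more testers.  As every labelling of the input by natural numbers has to
  be handled, vertex names carry no information on the number of vertices of the input.
\<close>

definition oblivious_one_sided_tester ::
  "graph set \<Rightarrow> (real \<Rightarrow> nat) \<Rightarrow> (real \<Rightarrow> rooted_graph \<Rightarrow> bool pmf) \<Rightarrow> bool" where
  "oblivious_one_sided_tester P q decide \<longleftrightarrow>
     (\<forall>\<epsilon>\<in>{0<..<1}. \<forall>G. simple_graph G \<longrightarrow>
        (G \<in> P \<longrightarrow> pmf (run_tester (q \<epsilon>) (decide \<epsilon>) G) True = 1) \<and>
        (far_from \<epsilon> P G \<longrightarrow> pmf (run_tester (q \<epsilon>) (decide \<epsilon>) G) False \<ge> 2 / 3))"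

definition has_oblivious_one_sided_tester :: "graph set \<Rightarrow> bool" where
  "has_oblivious_one_sided_tester P \<longleftrightarrow> (\<exists>q decide. oblivious_one_sided_tester P q decide)"

definition contains_copy :: "graph \<Rightarrow> graph \<Rightarrow> bool" where
  "contains_copy G F \<longleftrightarrow> (\<exists>F'. subgraph F' G \<and> isomorphic F F')"

definition uniformly_semi_subgraph_free :: "graph set \<Rightarrow> bool" where
  "uniformly_semi_subgraph_free P \<longleftrightarrow>
     (\<exists>b :: real \<Rightarrow> nat. \<forall>\<epsilon>\<in>{0<..<1}. \<exists>\<H>.
        finite \<H> \<and> card \<H> \<le> b \<epsilon> \<and>
        (\<forall>F\<in>\<H>. simple_graph F \<and> card (verts F) \<le> b \<epsilon>) \<and>
        (\<forall>G\<in>P. \<not> (\<exists>F\<in>\<H>. contains_copy G F)) \<and>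
        (\<forall>G. simple_graph G \<longrightarrow> far_from \<epsilon> P G \<longrightarrow> (\<exists>F\<in>\<H>. contains_copy G F)))"

end

theory Submission
  imports Defs
begin

text \<open>
  Whatever a traversal of a graph records can also be recorded in every graph that contains the
  recorded edges. So if the tester rejects a graph with positive probability after seeing a
  nonempty graph \<open>U\<close>, then no member of \<open>P\<close> contains a copy of \<open>U\<close>, where a traversal that starts
  at an isolated vertex, and thus records nothing, is simulated by repeating another one.
  Let \<open>\<H>\<close> consist of the graphs of bounded order that are contained in no member of \<open>P\<close>.

  It remains to exclude rejections after an empty view, which an isolated vertex can produce. If
  \<open>M \<in> P\<close> has no isolated vertex, let \<open>M'\<close> be \<open>M\<close> with an isolated vertex added. All nonempty views
  of \<open>M'\<close> are views of \<open>M\<close>, and so \<open>M'\<close> is rejected with probability at most \<open>1/2\<close>. Hence \<open>M'\<close> is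
  not far from \<open>P\<close>, for any \<open>\<epsilon>\<close>, and thus \<open>M' \<in> P\<close>. So a nonempty \<open>P\<close> has a member with an isolated
  vertex, and the empty view is accepted.
\<close>

section \<open>Isomorphic copies\<close>

definition relabel :: "(nat \<Rightarrow> nat) \<Rightarrow> graph \<Rightarrow> graph" where
  "relabel g G = \<lparr>verts = g ` verts G, edges = (\<lambda>e. g ` e) ` edges G\<rparr>"

lemma isomorphic_relabel: "inj_on g (verts G) \<Longrightarrow> isomorphic G (relabel g G)"
  unfolding isomorphic_def relabel_def by (auto simp: bij_betw_def)

lemma simple_graph_relabel:
  assumes "simple_graph G" "inj_on g (verts G)"
  shows "simple_graph (relabel g G)"
proof -
  have "card (g ` e) = 2" if "e \<in> edges G" for e
    using assms that by (metis card_image inj_on_subset simple_graph_def)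
  then show ?thesis
    using assms(1) by (auto simp: simple_graph_def relabel_def)
qed

lemma isomorphic_trans:
  assumes "isomorphic F G" "isomorphic G H"
  shows "isomorphic F H"
proof -
  obtain f where f: "bij_betw f (verts F) (verts G)" "edges G = (\<lambda>e. f ` e) ` edges F"
    using assms(1) unfolding isomorphic_def by (elim exE conjE)
  obtain g where g: "bij_betw g (verts G) (verts H)" "edges H = (\<lambda>e. g ` e) ` edges G"
    using assms(2) unfolding isomorphic_def by (elim exE conjE)
  have "edges H = (\<lambda>e. (g \<circ> f) ` e) ` edges F"
    unfolding g(2) f(2) by (simp add: image_image image_comp)
  then show ?thesis
    unfolding isomorphic_def using bij_betw_trans[OF f(1) g(1)] by blast
qed

lemma isomorphic_sym:
  assumes "simple_graph F" "isomorphic F G"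
  shows "isomorphic G F"
proof -
  obtain f where f: "bij_betw f (verts F) (verts G)" "edges G = (\<lambda>e. f ` e) ` edges F"
    using assms unfolding isomorphic_def by blast
  let ?g = "inv_into (verts F) f"
  have "?g ` f ` e = e" if "e \<in> edges F" for e
    using assms(1) f(1) that
    by (metis bij_betw_def inv_into_image_cancel simple_graph_def)
  then have "edges F = (\<lambda>e. ?g ` e) ` edges G"
    unfolding f(2) by (simp add: image_image)
  then show ?thesis
    unfolding isomorphic_def using bij_betw_inv_into[OF f(1)] by blast
qed

text \<open>Every graph of bounded order has one of finitely many labelled representatives. This
  keeps the forbidden family finite although vertices are arbitrary naturals.\<close>

lemma isomorphic_copy_below:
  assumes "simple_graph F" "card (verts F) \<le> B"
  obtains F0 where "simple_graph F0" "verts F0 \<subseteq> {..<B}" "isomorphic F0 F"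
proof -
  have "finite (verts F)" using assms by (simp add: simple_graph_def)
  then obtain g where g: "bij_betw g (verts F) {0..<card (verts F)}"
    using ex_bij_betw_finite_nat by blast
  then have inj: "inj_on g (verts F)" by (simp add: bij_betw_def)
  show ?thesis
  proof
    show "simple_graph (relabel g F)" by (rule simple_graph_relabel[OF assms(1) inj])
    show "verts (relabel g F) \<subseteq> {..<B}"
      using g assms(2) by (auto simp: relabel_def bij_betw_def)
    show "isomorphic (relabel g F) F"
      by (rule isomorphic_sym[OF assms(1) isomorphic_relabel[OF inj]])
  qed
qed

text \<open>A tester may look at vertex names, so a mere copy of a view is not enough to reproduce
  the view itself. The inverse of the embedding is therefore extended to all of \<open>G\<close>,
  which moves the copy back onto the vertices of \<open>F\<close> with their original names.\<close>

lemma contains_copy_isomorphic_supergraph: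
  assumes "simple_graph G" "simple_graph F" "contains_copy G F"
  obtains G' where "simple_graph G'" "isomorphic G G'" "verts F \<subseteq> verts G'" "edges F \<subseteq> edges G'"
proof -
  obtain F' f where sub: "subgraph F' G" and f: "bij_betw f (verts F) (verts F')"
    and eF': "edges F' = (\<lambda>e. f ` e) ` edges F"
    using assms(3) unfolding contains_copy_def isomorphic_def by blast
  define X where "X = verts G - verts F'"
  have finX: "finite X" and "finite (verts F)"
    using assms by (auto simp: X_def simple_graph_def)
  \<comment> \<open>The vertices of \<open>G\<close> outside the copy receive fresh names outside
    \<open>verts F\<close>, so that the extended renaming stays injective.\<close>
  then have "infinite (- verts F)" by (simp add: finite_compl)
  then obtain Y where Y: "finite Y" "card Y = card X" "Y \<subseteq> - verts F"
    using infinite_arbitrarily_large by blast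
  then obtain h where h: "bij_betw h X Y"
    using finX finite_same_card_bij by metis
  let ?i = "inv_into (verts F) f"
  define g where "g x = (if x \<in> verts F' then ?i x else h x)" for x
  have i: "bij_betw ?i (verts F') (verts F)" by (rule bij_betw_inv_into[OF f])
  have gF': "bij_betw g (verts F') (verts F)"
    using i by (rule bij_betw_cong[THEN iffD1, rotated]) (simp add: g_def)
  have gX: "bij_betw g X Y"
    using h by (rule bij_betw_cong[THEN iffD1, rotated]) (simp add: g_def X_def)
  have "bij_betw g (verts F' \<union> X) (verts F \<union> Y)"
    using gF' gX by (rule bij_betw_combine) (use Y in auto)
  moreover have "verts F' \<union> X = verts G"
    using sub by (auto simp: X_def subgraph_def)
  ultimately have g: "bij_betw g (verts G) (verts F \<union> Y)" by simp
  then have inj: "inj_on g (verts G)" by (simp add: bij_betw_def)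
  show ?thesis
  proof
    show "simple_graph (relabel g G)" by (rule simple_graph_relabel[OF assms(1) inj])
    show "isomorphic G (relabel g G)" by (rule isomorphic_relabel[OF inj])
    show "verts F \<subseteq> verts (relabel g G)"
      using g by (auto simp: relabel_def bij_betw_def)
    show "edges F \<subseteq> edges (relabel g G)"
    proof
      fix e assume e: "e \<in> edges F"
      then have e_sub: "e \<subseteq> verts F" using assms(2) by (simp add: simple_graph_def)
      have "g (f x) = x" if "x \<in> verts F" for x
        using f that by (simp add: g_def bij_betw_apply bij_betw_inv_into_left[OF f])
      then have "g ` f ` e = e"
        using e_sub by (simp add: image_image subset_iff cong: image_cong)
      moreover have "f ` e \<in> edges G"
        using e eF' sub by (auto simp: subgraph_def)
      ultimately show "e \<in> edges (relabel g G)"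
        unfolding relabel_def graph.simps by (metis imageI)
    qed
  qed
qed

section \<open>Possible outcomes of traversals\<close>

lemma finite_edges: "simple_graph G \<Longrightarrow> finite (edges G)"
  by (rule finite_subset[of _ "Pow (verts G)"]) (auto simp: simple_graph_def)

lemma neighbors_subset_verts: "simple_graph G \<Longrightarrow> neighbors G u \<subseteq> verts G"
  by (auto simp: neighbors_def simple_graph_def)

lemma finite_neighbors: "simple_graph G \<Longrightarrow> finite (neighbors G u)"
  by (meson finite_subset neighbors_subset_verts simple_graph_def)

lemma neighbors_sym: "x \<in> neighbors G u \<Longrightarrow> u \<in> neighbors G x"
  by (simp add: neighbors_def insert_commute)

lemma set_neighbor_queries:
  assumes "simple_graph G" "neighbors G u \<noteq> {}"
  shows "set_pmf (neighbor_queries G t u) =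
    set ` {xs. set xs \<subseteq> neighbors G u \<and> length xs = t}"
  using assms finite_neighbors[OF assms(1)]
  by (auto simp: neighbor_queries_def set_replicate_pmf in_lists_conv_set)

lemma neighbor_queries_subset_neighbors:
  assumes "simple_graph G" "Y \<in> set_pmf (neighbor_queries G t u)"
  shows "Y \<subseteq> neighbors G u" "finite Y" "card Y \<le> t"
  using assms set_neighbor_queries[OF assms(1), of u t] card_length
  by (cases "neighbors G u = {}"; force simp: neighbor_queries_def)+

text \<open>For a non-isolated vertex, the possible answers are the ranges of lists of length
  \<open>t\<close> over its neighbors, so only containment in the neighbor set matters. An isolated
  \<open>u\<close> in \<open>G\<close> would answer with the empty set, which is impossible in
  \<open>H\<close> if \<open>u\<close> has a neighbor there and \<open>t\<close> is
  positive.\<close>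

lemma neighbor_queries_transfer:
  assumes "simple_graph G" "simple_graph H" "neighbors G u \<noteq> {}"
    and "Y \<in> set_pmf (neighbor_queries G t u)" "Y \<subseteq> neighbors H u"
  shows "Y \<in> set_pmf (neighbor_queries H t u)"
proof (cases "neighbors H u = {}")
  case True
  then show ?thesis using assms(5) by (simp add: neighbor_queries_def)
next
  case False
  then show ?thesis
    using assms set_neighbor_queries by auto
qed

lemma set_traverse_levels_Suc:
  assumes "finite L"
  shows "set_pmf (traverse_levels (Suc d) G t A L R) =
    (\<Union>\<Gamma>\<in>PiE_dflt L {} (\<lambda>u. set_pmf (neighbor_queries G t u)).
      set_pmf (traverse_levels d G t (A \<union> L) ((\<Union>u\<in>L. \<Gamma> u) - (A \<union> L))
        (R \<union> {{u, x} | u x. u \<in> L \<and> x \<in> \<Gamma> u})))"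
  using assms by (simp add: set_Pi_pmf o_def)

lemma traverse_levels_SucE:
  assumes "finite L" "R' \<in> set_pmf (traverse_levels (Suc d) G t A L R)"
  obtains \<Gamma> where "\<Gamma> \<in> PiE_dflt L {} (\<lambda>u. set_pmf (neighbor_queries G t u))"
    and "\<And>u. u \<in> L \<Longrightarrow> \<Gamma> u \<in> set_pmf (neighbor_queries G t u)"
    and "R' \<in> set_pmf (traverse_levels d G t (A \<union> L) ((\<Union>u\<in>L. \<Gamma> u) - (A \<union> L))
        (R \<union> {{u, x} | u x. u \<in> L \<and> x \<in> \<Gamma> u}))"
proof -
  obtain \<Gamma> where \<Gamma>: "\<Gamma> \<in> PiE_dflt L {} (\<lambda>u. set_pmf (neighbor_queries G t u))"
    and R': "R' \<in> set_pmf (traverse_levels d G t (A \<union> L) ((\<Union>u\<in>L. \<Gamma> u) - (A \<union> L))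
        (R \<union> {{u, x} | u x. u \<in> L \<and> x \<in> \<Gamma> u}))"
    using assms(2) unfolding set_traverse_levels_Suc[OF assms(1)] by (rule UN_E)
  show ?thesis
    by (rule that[OF \<Gamma> _ R']) (use \<Gamma> in \<open>simp add: PiE_dflt_def\<close>)
qed

lemma traverse_levels_mono:
  assumes "simple_graph G" "finite L" "R' \<in> set_pmf (traverse_levels d G t A L R)"
  shows "R \<subseteq> R'"
  using assms(2,3)
proof (induction d arbitrary: A L R)
  case (Suc d)
  from Suc.prems obtain \<Gamma> where \<Gamma>: "\<And>u. u \<in> L \<Longrightarrow> \<Gamma> u \<in> set_pmf (neighbor_queries G t u)"
    and R': "R' \<in> set_pmf (traverse_levels d G t (A \<union> L) ((\<Union>u\<in>L. \<Gamma> u) - (A \<union> L))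
        (R \<union> {{u, x} | u x. u \<in> L \<and> x \<in> \<Gamma> u}))"
    by (rule traverse_levels_SucE) blast
  have "finite ((\<Union>u\<in>L. \<Gamma> u) - (A \<union> L))"
    using \<Gamma> Suc.prems(1) neighbor_queries_subset_neighbors(2)[OF assms(1)] by blast
  from Suc.IH[OF this R'] show ?case by blast
qed simp

lemma traverse_levels_subset_edges:
  assumes "simple_graph G" "finite L" "R \<subseteq> edges G"
    and "R' \<in> set_pmf (traverse_levels d G t A L R)"
  shows "R' \<subseteq> edges G"
  using assms(2-)
proof (induction d arbitrary: A L R)
  case (Suc d)
  from Suc.prems(1,3) obtain \<Gamma> where \<Gamma>: "\<And>u. u \<in> L \<Longrightarrow> \<Gamma> u \<in> set_pmf (neighbor_queries G t u)"
    and R': "R' \<in> set_pmf (traverse_levels d G t (A \<union> L) ((\<Union>u\<in>L. \<Gamma> u) - (A \<union> L))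
        (R \<union> {{u, x} | u x. u \<in> L \<and> x \<in> \<Gamma> u}))"
    by (rule traverse_levels_SucE) blast
  have "finite ((\<Union>u\<in>L. \<Gamma> u) - (A \<union> L))"
    using \<Gamma> Suc.prems(1) neighbor_queries_subset_neighbors(2)[OF assms(1)] by blast
  moreover have "R \<union> {{u, x} | u x. u \<in> L \<and> x \<in> \<Gamma> u} \<subseteq> edges G"
    using Suc.prems(2) neighbor_queries_subset_neighbors(1)[OF assms(1) \<Gamma>]
    by (auto simp: neighbors_def)
  ultimately show ?case using R' by (rule Suc.IH)
qed simp

text \<open>A level of at most \<open>l\<close> vertices records at most \<open>l * t\<close> edges
  and is followed by a level of at most \<open>l * t\<close> vertices. Hence \<open>N\<close>
  depends on \<open>l\<close>, \<open>d\<close> and \<open>t\<close> only, and \<open>l\<close> has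
  to vary in the induction.\<close>

lemma traverse_levels_card_bound:
  obtains N where "\<And>G A L R R'. simple_graph G \<Longrightarrow> finite L \<Longrightarrow> card L \<le> l \<Longrightarrow> finite R \<Longrightarrow>
    R' \<in> set_pmf (traverse_levels d G t A L R) \<Longrightarrow> card R' \<le> card R + N"
proof -
  have "\<exists>N. \<forall>G A L R R'. simple_graph G \<longrightarrow> finite L \<longrightarrow> card L \<le> l \<longrightarrow> finite R \<longrightarrow>
    R' \<in> set_pmf (traverse_levels d G t A L R) \<longrightarrow> card R' \<le> card R + N"
  proof (induction d arbitrary: l)
    case (Suc d)
    obtain N where N: "\<And>G A L R R'. simple_graph G \<Longrightarrow> finite L \<Longrightarrow> card L \<le> l * t \<Longrightarrow> finite R \<Longrightarrow>
      R' \<in> set_pmf (traverse_levels d G t A L R) \<Longrightarrow> card R' \<le> card R + N"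
      using Suc[of "l * t"] by blast
    \<comment> \<open>The summand \<open>l * t\<close> pays for the edges of the current round, and
      \<open>N\<close> for the remaining \<open>d\<close> rounds.\<close>
    have "card R' \<le> card R + (l * t + N)"
      if G: "simple_graph G" and L: "finite L" "card L \<le> l" and R: "finite R"
        and R': "R' \<in> set_pmf (traverse_levels (Suc d) G t A L R)" for G A L R R'
    proof -
      obtain \<Gamma> where \<Gamma>: "\<And>u. u \<in> L \<Longrightarrow> \<Gamma> u \<in> set_pmf (neighbor_queries G t u)"
        and R'': "R' \<in> set_pmf (traverse_levels d G t (A \<union> L) ((\<Union>u\<in>L. \<Gamma> u) - (A \<union> L))
          (R \<union> {{u, x} | u x. u \<in> L \<and> x \<in> \<Gamma> u}))"
        using L(1) R' by (rule traverse_levels_SucE) blast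
      have fin: "finite (\<Gamma> u)" and le: "card (\<Gamma> u) \<le> t" if "u \<in> L" for u
        using neighbor_queries_subset_neighbors(2,3)[OF G \<Gamma>[OF that]] by auto
      have sum: "(\<Sum>u\<in>L. card (\<Gamma> u)) \<le> l * t"
        using sum_bounded_above[of L "\<lambda>u. card (\<Gamma> u)" t] le L(2)
        by (metis mult_le_mono1 of_nat_id order_trans)
      have "card ((\<Union>u\<in>L. \<Gamma> u) - (A \<union> L)) \<le> card (\<Union>u\<in>L. \<Gamma> u)"
        by (rule card_mono) (use L fin in auto)
      also have "\<dots> \<le> l * t"
        using card_UN_le[OF L(1), of \<Gamma>] sum by linarith
      finally have next_level: "card ((\<Union>u\<in>L. \<Gamma> u) - (A \<union> L)) \<le> l * t" .
      have recorded: "{{u, x} | u x. u \<in> L \<and> x \<in> \<Gamma> u} = (\<lambda>(u, x). {u, x}) ` (SIGMA u:L. \<Gamma> u)"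
        by auto
      have fin_rec: "finite {{u, x} | u x. u \<in> L \<and> x \<in> \<Gamma> u}"
        unfolding recorded using L(1) fin by auto
      have "card {{u, x} | u x. u \<in> L \<and> x \<in> \<Gamma> u} \<le> card (SIGMA u:L. \<Gamma> u)"
        unfolding recorded by (rule card_image_le) (use L fin in auto)
      also have "\<dots> \<le> l * t"
        using L(1) fin sum by (simp add: card_SigmaI)
      finally have "card (R \<union> {{u, x} | u x. u \<in> L \<and> x \<in> \<Gamma> u}) \<le> card R + l * t"
        using card_Un_le[of R "{{u, x} | u x. u \<in> L \<and> x \<in> \<Gamma> u}"] by linarith
      moreover have "card R' \<le> card (R \<union> {{u, x} | u x. u \<in> L \<and> x \<in> \<Gamma> u}) + N"
        by (rule N[OF G _ next_level _ R'']) (use L R fin fin_rec in auto)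
      ultimately show ?thesis by linarith
    qed
    then show ?case by blast
  qed auto
  then show ?thesis using that by blast
qed

text \<open>Recorded edges are never dropped, so everything recorded on the way lies in
  \<open>R'\<close> and hence in \<open>H\<close>. Thus the same answers are possible in
  \<open>H\<close> and produce the same levels. The condition that no vertex of the level is
  isolated in \<open>G\<close> persists, since each vertex of the next level was reached from a
  neighbor.\<close>

lemma traverse_levels_transfer:
  assumes "simple_graph G" "simple_graph H" "finite L" "\<And>u. u \<in> L \<Longrightarrow> neighbors G u \<noteq> {}"
    and "R' \<in> set_pmf (traverse_levels d G t A L R)" "R' \<subseteq> edges H"
  shows "R' \<in> set_pmf (traverse_levels d H t A L R)"
  using assms(3-5)
proof (induction d arbitrary: A L R)
  case (Suc d)
  let ?L = "\<lambda>\<Gamma>. (\<Union>u\<in>L. \<Gamma> u) - (A \<union> L)"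
  let ?R = "\<lambda>\<Gamma>. R \<union> {{u, x} | u x. u \<in> L \<and> x \<in> \<Gamma> u}"
  obtain \<Gamma> where \<Gamma>: "\<Gamma> \<in> PiE_dflt L {} (\<lambda>u. set_pmf (neighbor_queries G t u))"
    and R': "R' \<in> set_pmf (traverse_levels d G t (A \<union> L) (?L \<Gamma>) (?R \<Gamma>))"
    and mem: "\<And>u. u \<in> L \<Longrightarrow> \<Gamma> u \<in> set_pmf (neighbor_queries G t u)"
    using Suc.prems(1,3) by (rule traverse_levels_SucE) blast
  have fin: "finite (?L \<Gamma>)"
    using mem Suc.prems(1) neighbor_queries_subset_neighbors(2)[OF assms(1)] by blast
  have "?R \<Gamma> \<subseteq> edges H"
    using traverse_levels_mono[OF assms(1) fin R'] assms(6) by blast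
  then have "\<Gamma> u \<subseteq> neighbors H u" if "u \<in> L" for u
    using that by (auto simp: neighbors_def)
  then have \<Gamma>H: "\<Gamma> \<in> PiE_dflt L {} (\<lambda>u. set_pmf (neighbor_queries H t u))"
    using \<Gamma> neighbor_queries_transfer[OF assms(1,2) Suc.prems(2)] by (simp add: PiE_dflt_def)
  have "neighbors G x \<noteq> {}" if "x \<in> ?L \<Gamma>" for x
    using that mem neighbor_queries_subset_neighbors(1)[OF assms(1)] neighbors_sym by blast
  from Suc.IH[OF fin this R'] show ?case
    unfolding set_traverse_levels_Suc[OF Suc.prems(1)] using \<Gamma>H by blast
qed simp

lemma traverse_levels_empty_level: "traverse_levels d G t A {} R = return_pmf R"
  by (induction d arbitrary: A) (simp_all add: bind_return_pmf)

lemma traverse_isolated: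
  assumes "neighbors G v = {}"
  shows "traverse G v d t = return_pmf (recorded_graph v {})"
proof (cases d)
  case (Suc d')
  have "Pi_pmf {v} {} (neighbor_queries G t) = return_pmf (\<lambda>_. {})"
    using assms by (subst Pi_pmf_singleton) (auto simp: neighbor_queries_def fun_eq_iff)
  then show ?thesis
    by (simp add: Suc traverse_def bind_return_pmf traverse_levels_empty_level)
qed (simp add: traverse_def)

lemma recorded_graph_empty: "recorded_graph v {} = \<lparr>verts = {}, edges = {}, roots = {}\<rparr>"
  by (simp add: recorded_graph_def)

lemma edges_recorded_graph [simp]: "edges (recorded_graph v R) = R"
  and verts_recorded_graph [simp]: "verts (recorded_graph v R) = \<Union>R"
  by (simp_all add: recorded_graph_def)

text \<open>This makes the start vertex visible in the recorded edges. Any graph containing these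
  edges then contains the start vertex, which can be sampled there.\<close>

lemma traverse_non_isolated:
  assumes "simple_graph G" "neighbors G v \<noteq> {}" "d > 0" "t > 0" "W \<in> set_pmf (traverse G v d t)"
  shows "\<exists>x. {v, x} \<in> edges W"
proof -
  obtain d' where d: "d = Suc d'" using assms(3) gr0_implies_Suc by blast
  obtain R where W: "W = recorded_graph v R"
    and "R \<in> set_pmf (traverse_levels (Suc d') G t {} {v} {})"
    using assms(5) unfolding traverse_def d by auto
  then obtain \<Gamma> where \<Gamma>: "\<Gamma> v \<in> set_pmf (neighbor_queries G t v)"
    and R: "R \<in> set_pmf (traverse_levels d' G t ({} \<union> {v}) ((\<Union>u\<in>{v}. \<Gamma> u) - ({} \<union> {v}))
        ({} \<union> {{u, x} | u x. u \<in> {v} \<and> x \<in> \<Gamma> u}))"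
    by (subst (asm) set_traverse_levels_Suc) (auto simp: PiE_dflt_def)
  have "finite ((\<Union>u\<in>{v}. \<Gamma> u) - ({} \<union> {v}))"
    using neighbor_queries_subset_neighbors(2)[OF assms(1) \<Gamma>] by auto
  from traverse_levels_mono[OF assms(1) this R]
  have "{v, x} \<in> R" if "x \<in> \<Gamma> v" for x using that by auto
  moreover have "\<Gamma> v \<noteq> {}"
    using \<Gamma> assms(4) unfolding set_neighbor_queries[OF assms(1,2)] by auto
  ultimately show ?thesis unfolding W by auto
qed

lemma traverse_transfer:
  assumes "simple_graph G" "simple_graph H" "neighbors G v \<noteq> {}"
    and "W \<in> set_pmf (traverse G v d t)" "edges W \<subseteq> edges H"
  shows "W \<in> set_pmf (traverse H v d t)"
proof -
  obtain R where "W = recorded_graph v R" "R \<in> set_pmf (traverse_levels d G t {} {v} {})"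
    using assms(4) unfolding traverse_def by auto
  then show ?thesis
    using traverse_levels_transfer[OF assms(1,2), of "{v}" R d t "{}" "{}"] assms(3,5)
    unfolding traverse_def by auto
qed

lemma traverse_subset_edges:
  assumes "simple_graph G" "W \<in> set_pmf (traverse G v d t)"
  shows "edges W \<subseteq> edges G" "verts W = \<Union>(edges W)"
proof -
  obtain R where W: "W = recorded_graph v R"
    and R: "R \<in> set_pmf (traverse_levels d G t {} {v} {})"
    using assms(2) unfolding traverse_def by auto
  show "edges W \<subseteq> edges G" "verts W = \<Union>(edges W)"
    using traverse_levels_subset_edges[OF assms(1) _ _ R] by (simp_all add: W)
qed

lemma traverse_card_bound:
  obtains N where
    "\<And>G v W. simple_graph G \<Longrightarrow> W \<in> set_pmf (traverse G v d t) \<Longrightarrow> card (verts W) \<le> N"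
proof -
  obtain N where N: "\<And>G A L R R'. simple_graph G \<Longrightarrow> finite L \<Longrightarrow> card L \<le> 1 \<Longrightarrow> finite R \<Longrightarrow>
    R' \<in> set_pmf (traverse_levels d G t A L R) \<Longrightarrow> card R' \<le> card R + N"
    using traverse_levels_card_bound[where l = 1 and d = d and t = t] by blast
  \<comment> \<open>At most \<open>N\<close> edges are recorded, and every vertex of
    \<open>W\<close> is an end of one of them.\<close>
  have "card (verts W) \<le> N * 2"
    if G: "simple_graph G" and W: "W \<in> set_pmf (traverse G v d t)" for G v W
  proof -
    have "card (edges W) \<le> N"
      using W N[OF G, of "{v}" "{}"] by (auto simp: traverse_def)
    moreover have "card e = 2" if "e \<in> edges W" for e
      using that traverse_subset_edges(1)[OF G W] G by (auto simp: simple_graph_def)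
    ultimately have "(\<Sum>e\<in>edges W. card e) \<le> N * 2" by simp
    then show ?thesis
      unfolding traverse_subset_edges(2)[OF G W]
      using card_Union_le_sum_card[of "edges W"] by linarith
  qed
  then show ?thesis by (rule that)
qed

section \<open>Views of a tester\<close>

definition samples :: "nat \<Rightarrow> graph \<Rightarrow> (nat \<Rightarrow> nat) pmf" where
  "samples q G = Pi_pmf {..<q} 0 (\<lambda>_. pmf_of_set (verts G))"

definition traversals :: "nat \<Rightarrow> graph \<Rightarrow> (nat \<Rightarrow> nat) \<Rightarrow> (nat \<Rightarrow> rooted_graph) pmf" where
  "traversals q G s = Pi_pmf {..<q} (recorded_graph 0 {}) (\<lambda>i. traverse G (s i) q q)"

lemma run_tester_eq:
  "run_tester q decide G =
     bind_pmf (samples q G) (\<lambda>s. bind_pmf (traversals q G s) (\<lambda>U. decide (union_graph {..<q} U)))"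
  by (simp add: run_tester_def samples_def traversals_def)

text \<open>One-sided error constrains the decision on every view of positive probability, so for
  members of \<open>P\<close> the support carries all the information that is needed.\<close>

definition views :: "nat \<Rightarrow> graph \<Rightarrow> rooted_graph set" where
  "views q G = (\<Union>s\<in>set_pmf (samples q G). union_graph {..<q} ` set_pmf (traversals q G s))"

lemma set_run_tester: "set_pmf (run_tester q decide G) = (\<Union>V\<in>views q G. set_pmf (decide V))"
  by (simp add: run_tester_eq views_def)

lemma set_samples:
  "simple_graph G \<Longrightarrow> set_pmf (samples q G) = PiE_dflt {..<q} 0 (\<lambda>_. verts G)"
  unfolding samples_def by (subst set_Pi_pmf) (auto simp: simple_graph_def o_def)

lemma set_traversals:
  "set_pmf (traversals q G s) =
     PiE_dflt {..<q} (recorded_graph 0 {}) (\<lambda>i. set_pmf (traverse G (s i) q q))"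
  unfolding traversals_def by (subst set_Pi_pmf) (auto simp: o_def)

lemma union_graph_in_views:
  assumes "simple_graph G" "\<And>i. i < q \<Longrightarrow> s i \<in> verts G"
    and "\<And>i. i < q \<Longrightarrow> U i \<in> set_pmf (traverse G (s i) q q)"
  shows "union_graph {..<q} U \<in> views q G"
proof -
  \<comment> \<open>Outside \<open>{..<q}\<close> the functions have to take the default values of
    the two products; the union does not see this change.\<close>
  let ?s = "\<lambda>i. if i < q then s i else 0" and ?U = "\<lambda>i. if i < q then U i else recorded_graph 0 {}"
  have "union_graph {..<q} U = union_graph {..<q} ?U"
    by (simp add: union_graph_def)
  moreover have "?s \<in> set_pmf (samples q G)"
    using assms(2) by (simp add: set_samples[OF assms(1)] PiE_dflt_def)
  moreover have "?U \<in> set_pmf (traversals q G ?s)"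
    using assms(3) by (simp add: set_traversals PiE_dflt_def)
  ultimately show ?thesis unfolding views_def by blast
qed

abbreviation (input) empty_view :: rooted_graph where
  "empty_view \<equiv> \<lparr>verts = {}, edges = {}, roots = {}\<rparr>"

lemma empty_view_in_views:
  assumes "simple_graph G" "v \<in> verts G" "neighbors G v = {}"
  shows "empty_view \<in> views q G"
proof -
  have "union_graph {..<q} (\<lambda>_. recorded_graph v {}) \<in> views q G"
    by (rule union_graph_in_views[where s = "\<lambda>_. v"]) (use assms in \<open>auto simp: traverse_isolated\<close>)
  then show ?thesis by (simp add: union_graph_def recorded_graph_def)
qed

text \<open>A start vertex that is isolated in \<open>G\<close> may be absent from \<open>H\<close>
  or have neighbors there. Its traversal contributes nothing to the union, so it can be replaced by
  a repetition of the traversal with index \<open>i0\<close>; repetitions are allowed because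
  samples are drawn with replacement.\<close>

lemma view_transfer:
  assumes G: "simple_graph G" and H: "simple_graph H"
    and U: "\<And>i. i < q \<Longrightarrow> U i \<in> set_pmf (traverse G (s i) q q)"
    and sub: "edges (union_graph {..<q} U) \<subseteq> edges H"
    and i0: "i0 < q" "neighbors G (s i0) \<noteq> {}"
  shows "union_graph {..<q} U \<in> views q H"
proof -
  \<comment> \<open>\<open>J\<close> redirects the indices of isolated samples to \<open>i0\<close>
    and fixes all others.\<close>
  define J where "J i = (if neighbors G (s i) = {} then i0 else i)" for i
  have J: "J i < q" "neighbors G (s (J i)) \<noteq> {}" if "i < q" for i
    using that i0 by (auto simp: J_def)
  have subU: "edges (U i) \<subseteq> edges H" if "i < q" for i
    using sub that by (auto simp: union_graph_def)
  have "s (J i) \<in> verts H" if i: "i < q" for i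
  proof -
    obtain x where "{s (J i), x} \<in> edges (U (J i))"
      using traverse_non_isolated[OF G J(2)[OF i] _ _ U[OF J(1)[OF i]]] i0(1) by auto
    then have "{s (J i), x} \<in> edges H" using subU[OF J(1)[OF i]] by blast
    then show ?thesis using H by (auto simp: simple_graph_def)
  qed
  moreover have "U (J i) \<in> set_pmf (traverse H (s (J i)) q q)" if "i < q" for i
    by (rule traverse_transfer[OF G H]) (use J[OF that] U subU in auto)
  ultimately have view: "union_graph {..<q} (\<lambda>i. U (J i)) \<in> views q H"
    by (rule union_graph_in_views[OF H, where s = "\<lambda>i. s (J i)"])
  have triv: "U i = empty_view" if "i < q" "neighbors G (s i) = {}" for i
    using U[OF that(1)] that(2) by (simp add: traverse_isolated recorded_graph_empty)
  \<comment> \<open>Redirecting indices changes none of the unions of \<open>verts\<close>,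
    \<open>edges\<close> and \<open>roots\<close>, as all three are empty for an isolated
    start.\<close>
  have eq: "(\<Union>i\<in>{..<q}. f (U (J i))) = (\<Union>i\<in>{..<q}. f (U i))"
    if "f empty_view = {}" for f :: "rooted_graph \<Rightarrow> 'a set"
  proof
    show "(\<Union>i\<in>{..<q}. f (U (J i))) \<subseteq> (\<Union>i\<in>{..<q}. f (U i))"
      using J(1) by blast
    show "(\<Union>i\<in>{..<q}. f (U i)) \<subseteq> (\<Union>i\<in>{..<q}. f (U (J i)))"
    proof
      fix x assume "x \<in> (\<Union>i\<in>{..<q}. f (U i))"
      then obtain i where i: "i < q" "x \<in> f (U i)" by auto
      then have "J i = i" using triv that by (auto simp: J_def)
      then show "x \<in> (\<Union>i\<in>{..<q}. f (U (J i)))" using i by force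
    qed
  qed
  have "union_graph {..<q} (\<lambda>i. U (J i)) = union_graph {..<q} U"
    unfolding union_graph_def by (simp add: eq)
  then show ?thesis using view by simp
qed

text \<open>If all samples are isolated, nothing is recorded. Otherwise some traversal records an
  edge, so the view has a vertex, and that traversal can serve as the repeated one in
  \<open>view_transfer\<close>.\<close>

lemma view_cases:
  assumes G: "simple_graph G" and V: "V \<in> views q G"
  shows "V = empty_view \<or>
    (simple_graph \<lparr>verts = verts V, edges = edges V\<rparr> \<and>
     subgraph \<lparr>verts = verts V, edges = edges V\<rparr> G \<and>
     (\<forall>H. simple_graph H \<longrightarrow> edges V \<subseteq> edges H \<longrightarrow> V \<in> views q H))"
proof -
  obtain s U where V: "V = union_graph {..<q} U"
    and s: "\<And>i. i < q \<Longrightarrow> s i \<in> verts G"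
    and U: "\<And>i. i < q \<Longrightarrow> U i \<in> set_pmf (traverse G (s i) q q)"
    using V by (auto simp: views_def set_samples[OF G] set_traversals PiE_dflt_def)
  show ?thesis
  proof (cases "\<exists>i<q. neighbors G (s i) \<noteq> {}")
    case False
    then have "U i = empty_view" if "i < q" for i
      using U[OF that] that by (simp add: traverse_isolated recorded_graph_empty)
    then show ?thesis by (simp add: V union_graph_def)
  next
    case True
    then obtain i0 where i0: "i0 < q" "neighbors G (s i0) \<noteq> {}" by blast
    then obtain x where "{s i0, x} \<in> edges (U i0)"
      using traverse_non_isolated[OF G _ _ _ U] by blast
    then have ne: "edges V \<noteq> {}" using i0(1) by (auto simp: V union_graph_def)
    have vV: "verts V = \<Union>(edges V)"
      using traverse_subset_edges(2)[OF G U] by (auto simp: V union_graph_def)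
    have eV: "edges V \<subseteq> edges G"
      using traverse_subset_edges(1)[OF G U] by (auto simp: V union_graph_def)
    have subV: "verts V \<subseteq> verts G"
      using G eV by (auto simp: vV simple_graph_def)
    have "\<And>e. e \<in> edges V \<Longrightarrow> card e = 2"
      using G eV by (auto simp: simple_graph_def)
    moreover from this have "verts V \<noteq> {}" using ne unfolding vV by fastforce
    ultimately have simple: "simple_graph \<lparr>verts = verts V, edges = edges V\<rparr>"
      using G subV finite_subset vV by (auto simp: simple_graph_def)
    have "V \<in> views q H" if "simple_graph H" "edges V \<subseteq> edges H" for H
      unfolding V by (rule view_transfer[where s = s, OF G that(1) U _ i0]) (use that in \<open>auto simp: V\<close>)
    then show ?thesis
      using simple subV eV ne by (auto simp: subgraph_def)
  qed
qed

lemma view_card_bound: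
  obtains B where "\<And>G V. simple_graph G \<Longrightarrow> V \<in> views q G \<Longrightarrow> card (verts V) \<le> B"
proof -
  obtain N where N: "\<And>G v W. simple_graph G \<Longrightarrow> W \<in> set_pmf (traverse G v q q) \<Longrightarrow>
    card (verts W) \<le> N"
    using traverse_card_bound[where d = q and t = q] by blast
  have "card (verts V) \<le> q * N" if G: "simple_graph G" and V: "V \<in> views q G" for G V
  proof -
    obtain s U where V: "V = union_graph {..<q} U"
      and U: "\<And>i. i < q \<Longrightarrow> U i \<in> set_pmf (traverse G (s i) q q)"
      using V by (auto simp: views_def set_traversals PiE_dflt_def)
    have "card (verts V) \<le> (\<Sum>i<q. card (verts (U i)))"
      using card_UN_le[of "{..<q}" "\<lambda>i. verts (U i)"] by (simp add: V union_graph_def)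
    also have "\<dots> \<le> (\<Sum>i<q. N)"
      by (rule sum_mono) (use N[OF G U] in auto)
    finally show ?thesis by simp
  qed
  then show ?thesis by (rule that)
qed

section \<open>Isolated vertices\<close>

text \<open>A nonmember differs from each member on the same vertices in at least one edge, and this
  already exceeds a budget below 1.\<close>

lemma far_from_small:
  assumes "graph_property P" "simple_graph G" "G \<notin> P" "\<epsilon> * real (card (verts G)) < 1"
  shows "far_from \<epsilon> P G"
  unfolding far_from_def
proof (intro ballI impI)
  fix H assume H: "H \<in> P" "verts H = verts G"
  have "finite (edges G)" "finite (edges H)"
    using assms(1,2) H(1) finite_edges unfolding graph_property_def by blast+
  moreover have "edges G \<noteq> edges H"
  proof
    assume "edges G = edges H"
    then have "G = H" using H(2) by (intro graph.equality) auto
    then show False using H(1) assms(3) by simp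
  qed
  ultimately have "edge_modifications G H \<noteq> 0"
    by (auto simp: edge_modifications_def)
  then show "real (edge_modifications G H) > \<epsilon> * real (card (verts G))"
    using assms(4) by linarith
qed

definition add_isolated :: "nat \<Rightarrow> graph \<Rightarrow> graph" where
  "add_isolated z G = \<lparr>verts = insert z (verts G), edges = edges G\<rparr>"

lemma simple_graph_add_isolated: "simple_graph G \<Longrightarrow> simple_graph (add_isolated z G)"
  by (auto simp: simple_graph_def add_isolated_def)

lemma neighbors_add_isolated: "neighbors (add_isolated z G) = neighbors G"
  by (simp add: neighbors_def add_isolated_def fun_eq_iff)

text \<open>It suffices to look at the first sample. If it differs from \<open>z\<close>, then it
  has a neighbor, so the whole view transfers to \<open>M\<close> even if later samples hit
  \<open>z\<close>, and it is accepted. For \<open>q = 0\<close> the only view is shared with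
  \<open>M\<close>.\<close>

lemma reject_add_isolated_le_half:
  assumes M: "simple_graph M" and z: "z \<notin> verts M"
    and no_isolated: "\<And>v. v \<in> verts M \<Longrightarrow> neighbors M v \<noteq> {}"
    and acc: "\<And>V. V \<in> views q M \<Longrightarrow> pmf (decide V) False = 0"
  shows "pmf (run_tester q decide (add_isolated z M)) False \<le> 1 / 2"
proof -
  let ?M = "add_isolated z M"
  have M': "simple_graph ?M" by (rule simple_graph_add_isolated[OF M])
  have acc': "pmf (bind_pmf (traversals q ?M s) (\<lambda>U. decide (union_graph {..<q} U))) False = 0"
    if s: "s \<in> set_pmf (samples q ?M)" and s0: "q = 0 \<or> s 0 \<noteq> z" for s
  proof -
    have "union_graph {..<q} U \<in> views q M" if U: "U \<in> set_pmf (traversals q ?M s)" for U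
    proof (cases "q = 0")
      case True
      then show ?thesis using union_graph_in_views[OF M, of q] by simp
    next
      case False
      have mem: "U i \<in> set_pmf (traverse ?M (s i) q q)" if "i < q" for i
        using U that by (simp add: set_traversals PiE_dflt_def)
      have "s 0 \<in> verts ?M" using s False by (simp add: set_samples[OF M'] PiE_dflt_def)
      then have "s 0 \<in> verts M" using s0 False by (simp add: add_isolated_def)
      then have ne: "neighbors ?M (s 0) \<noteq> {}"
        using no_isolated by (simp add: neighbors_add_isolated)
      have "edges (union_graph {..<q} U) \<subseteq> edges M"
        using traverse_subset_edges(1)[OF M' mem]
        by (fastforce simp: union_graph_def add_isolated_def)
      then show ?thesis using view_transfer[where s = s, OF M' M mem _ _ ne] False by simp
    qed
    then have "pmf (decide (union_graph {..<q} U)) False = 0"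
      if "U \<in> set_pmf (traversals q ?M s)" for U
      using acc that by blast
    then show ?thesis by (auto simp: pmf_eq_0_set_pmf)
  qed
  show ?thesis
  proof (cases "q = 0")
    case True
    then have "False \<notin> set_pmf (run_tester q decide ?M)"
      using acc' by (auto simp: run_tester_eq pmf_eq_0_set_pmf)
    then show ?thesis by (simp add: pmf_eq_0_set_pmf[symmetric])
  next
    case False
    have fin: "finite (verts M)" "verts M \<noteq> {}" using M by (auto simp: simple_graph_def)
    have "pmf (run_tester q decide ?M) False =
      measure_pmf.expectation (samples q ?M)
        (\<lambda>s. pmf (bind_pmf (traversals q ?M s) (\<lambda>U. decide (union_graph {..<q} U))) False)"
      unfolding run_tester_eq by (rule pmf_bind)
    \<comment> \<open>Given the samples \<open>s\<close>, the probability of rejection is 0 unless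
      \<open>s 0 = z\<close>, and at most 1 in that case.\<close>
    also have "\<dots> \<le> measure_pmf.expectation (samples q ?M) (indicator {s. s 0 = z})"
    proof (rule integral_mono_AE)
      show "integrable (samples q ?M)
          (\<lambda>s. pmf (bind_pmf (traversals q ?M s) (\<lambda>U. decide (union_graph {..<q} U))) False)"
        by (rule measure_pmf.integrable_const_bound[where B = 1]) (auto simp: pmf_le_1)
      show "AE s in samples q ?M.
          pmf (bind_pmf (traversals q ?M s) (\<lambda>U. decide (union_graph {..<q} U))) False
            \<le> indicator {s. s 0 = z} s"
        by (rule AE_pmfI) (auto simp: acc' pmf_le_1 indicator_def)
      show "integrable (samples q ?M) (indicator {s. s 0 = z} :: _ \<Rightarrow> real)"
        by (rule measure_pmf.integrable_const_bound[where B = 1]) (auto simp: indicator_def)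
    qed
    also have "\<dots> = measure_pmf.prob (map_pmf (\<lambda>s. s 0) (samples q ?M)) {z}"
      by (simp add: vimage_def)
    also have "map_pmf (\<lambda>s. s 0) (samples q ?M) = pmf_of_set (verts ?M)"
      unfolding samples_def using False by (subst Pi_pmf_component) auto
    also have "measure_pmf.prob (pmf_of_set (verts ?M)) {z} = 1 / real (card (verts M) + 1)"
      using fin z by (simp add: measure_pmf_single add_isolated_def)
    \<comment> \<open>\<open>M\<close> has at least one vertex, so \<open>z\<close> is one of at
      least two equally likely samples.\<close>
    also have "\<dots> \<le> 1 / 2"
      using fin by (simp add: field_simps Suc_le_eq card_gt_0_iff)
    finally show ?thesis .
  qed
qed

text \<open>Acceptance with probability 1 leaves no room for a rejection on any view of positive
  probability.\<close>

lemma accepted_views: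
  assumes "oblivious_one_sided_tester P q decide" "\<epsilon> \<in> {0<..<1}"
    and "simple_graph G" "G \<in> P" "V \<in> views (q \<epsilon>) G"
  shows "pmf (decide \<epsilon> V) False = 0"
proof -
  have "pmf (run_tester (q \<epsilon>) (decide \<epsilon>) G) True = 1"
    using assms by (auto simp: oblivious_one_sided_tester_def)
  then have "False \<notin> set_pmf (run_tester (q \<epsilon>) (decide \<epsilon>) G)"
    by (simp add: pmf_eq_0_set_pmf[symmetric] pmf_False_conv_True)
  then show ?thesis
    using assms(5) by (auto simp: set_run_tester pmf_eq_0_set_pmf)
qed

text \<open>The tester works for every proximity parameter, so the parameter may be adapted to the
  order of a single graph. The member obtained can afterwards be used with any other
  parameter.\<close>

lemma ex_member_with_isolated_vertex:
  assumes P: "graph_property P" and T: "oblivious_one_sided_tester P q decide" and "P \<noteq> {}"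
  obtains G v where "G \<in> P" "v \<in> verts G" "neighbors G v = {}"
proof (cases "\<exists>G\<in>P. \<exists>v\<in>verts G. neighbors G v = {}")
  case True
  then show ?thesis using that by blast
next
  case False
  obtain M where M: "M \<in> P" using \<open>P \<noteq> {}\<close> by blast
  then have sM: "simple_graph M" using P by (simp add: graph_property_def)
  then obtain z where z: "z \<notin> verts M"
    by (metis ex_new_if_finite infinite_UNIV_nat simple_graph_def)
  let ?M = "add_isolated z M"
  have sM': "simple_graph ?M" by (rule simple_graph_add_isolated[OF sM])
  \<comment> \<open>With this choice the budget of edge modifications on \<open>?M\<close> is below
    1, so being outside \<open>P\<close> would mean being far from \<open>P\<close>. Rejection would
    then need probability 2/3, which exceeds 1/2.\<close>
  define \<epsilon> :: real where "\<epsilon> = 1 / real (card (verts ?M) + 1)"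
  have "card (verts ?M) > 0" using sM' by (simp add: simple_graph_def card_gt_0_iff)
  then have \<epsilon>: "\<epsilon> \<in> {0<..<1}" by (simp add: \<epsilon>_def)
  have "pmf (run_tester (q \<epsilon>) (decide \<epsilon>) ?M) False \<le> 1 / 2"
    by (rule reject_add_isolated_le_half[OF sM z])
      (use False M accepted_views[OF T \<epsilon> sM M] in auto)
  then have "\<not> far_from \<epsilon> P ?M"
    using T \<epsilon> sM' unfolding oblivious_one_sided_tester_def by force
  moreover have "\<epsilon> * real (card (verts ?M)) < 1" by (simp add: \<epsilon>_def field_simps)
  ultimately have "?M \<in> P" using far_from_small[OF P sM'] by blast
  moreover have "neighbors ?M z = {}"
    using z neighbors_sym neighbors_subset_verts[OF sM]
    by (fastforce simp: neighbors_add_isolated)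
  ultimately show ?thesis
    using that[of ?M z] by (simp add: add_isolated_def)
qed

section \<open>The forbidden subgraphs\<close>

lemma finite_graphs_below: "finite {F :: graph. simple_graph F \<and> verts F \<subseteq> {..<B}}"
proof (rule finite_subset)
  show "{F. simple_graph F \<and> verts F \<subseteq> {..<B}} \<subseteq>
    (\<lambda>(X, E). \<lparr>verts = X, edges = E\<rparr>) ` (Pow {..<B} \<times> Pow (Pow {..<B}))"
  proof
    fix F :: graph assume "F \<in> {F. simple_graph F \<and> verts F \<subseteq> {..<B}}"
    then have "(verts F, edges F) \<in> Pow {..<B} \<times> Pow (Pow {..<B})"
      by (auto simp: simple_graph_def)
    moreover have "F = (\<lambda>(X, E). \<lparr>verts = X, edges = E\<rparr>) (verts F, edges F)" by simp
    ultimately show "F \<in> (\<lambda>(X, E). \<lparr>verts = X, edges = E\<rparr>) ` (Pow {..<B} \<times> Pow (Pow {..<B}))"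
      by (rule rev_image_eqI)
  qed
qed simp

lemma forbidden_family:
  assumes P: "graph_property P" and T: "oblivious_one_sided_tester P q decide"
    and \<epsilon>: "\<epsilon> \<in> {0<..<1}"
  shows "\<exists>B. \<forall>G. simple_graph G \<longrightarrow> far_from \<epsilon> P G \<longrightarrow>
    (\<exists>F. simple_graph F \<and> verts F \<subseteq> {..<B} \<and> (\<forall>H\<in>P. \<not> contains_copy H F) \<and> contains_copy G F)"
proof (cases "P = {}")
  case True
  \<comment> \<open>An empty property has no member with an isolated vertex, but then a single
    vertex can be forbidden, since every graph contains it.\<close>
  let ?K = "\<lparr>verts = {0}, edges = {}\<rparr>"
  have "simple_graph ?K" by (simp add: simple_graph_def)
  moreover have "contains_copy G ?K" if "simple_graph G" for G
  proof -
    obtain v where "v \<in> verts G" using \<open>simple_graph G\<close> by (auto simp: simple_graph_def)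
    then have "subgraph \<lparr>verts = {v}, edges = {}\<rparr> G" by (simp add: subgraph_def simple_graph_def)
    moreover have "isomorphic ?K \<lparr>verts = {v}, edges = {}\<rparr>"
      by (auto simp: isomorphic_def bij_betw_def)
    ultimately show ?thesis unfolding contains_copy_def by blast
  qed
  ultimately show ?thesis
    using True by (intro exI[of _ 1] allI impI exI[of _ ?K]) auto
next
  case False
  have simple: "simple_graph G" if "G \<in> P" for G using P that by (simp add: graph_property_def)
  obtain G0 v where G0: "G0 \<in> P" "v \<in> verts G0" "neighbors G0 v = {}"
    by (rule ex_member_with_isolated_vertex[OF P T False])
  \<comment> \<open>All samples may hit the isolated vertex \<open>v\<close> of \<open>G0\<close>,
    so the empty view occurs for a member of \<open>P\<close>.\<close>
  have empty_accepted: "pmf (decide \<epsilon> empty_view) False = 0"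
    by (rule accepted_views[OF T \<epsilon> simple[OF G0(1)] G0(1)
        empty_view_in_views[OF simple[OF G0(1)] G0(2,3)]])
  obtain B where B: "\<And>G V. simple_graph G \<Longrightarrow> V \<in> views (q \<epsilon>) G \<Longrightarrow> card (verts V) \<le> B"
    using view_card_bound[where q = "q \<epsilon>"] by blast
  have "\<exists>F. simple_graph F \<and> verts F \<subseteq> {..<B} \<and> (\<forall>H\<in>P. \<not> contains_copy H F) \<and> contains_copy G F"
    if G: "simple_graph G" and far: "far_from \<epsilon> P G" for G
  proof -
    have "pmf (run_tester (q \<epsilon>) (decide \<epsilon>) G) False \<noteq> 0"
      using T \<epsilon> G far unfolding oblivious_one_sided_tester_def by force
    then obtain V where V: "V \<in> views (q \<epsilon>) G" and rej: "pmf (decide \<epsilon> V) False \<noteq> 0"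
      by (auto simp: pmf_eq_0_set_pmf set_run_tester)
    let ?F = "\<lparr>verts = verts V, edges = edges V\<rparr>"
    have F: "simple_graph ?F" "subgraph ?F G"
      and transfer: "\<And>H. simple_graph H \<Longrightarrow> edges V \<subseteq> edges H \<Longrightarrow> V \<in> views (q \<epsilon>) H"
      using view_cases[OF G V] rej empty_accepted by auto
    \<comment> \<open>The rejected view is renamed into \<open>{..<B}\<close>; since
      \<open>B\<close> depends on \<open>q \<epsilon>\<close> only, the range of candidates does not
      depend on \<open>G\<close>.\<close>
    obtain F0 where F0: "simple_graph F0" "verts F0 \<subseteq> {..<B}" "isomorphic F0 ?F"
      using isomorphic_copy_below[OF F(1), of B] B[OF G V] by auto
    have "\<not> contains_copy H F0" if H: "H \<in> P" for H
    proof
      assume "contains_copy H F0"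
      then have "contains_copy H ?F"
        using isomorphic_trans[OF isomorphic_sym[OF F0(1,3)]] unfolding contains_copy_def by blast
      \<comment> \<open>Closure under isomorphism allows passing to a member \<open>H'\<close> that
        contains \<open>V\<close> under its original names. There \<open>V\<close> is a possible
        view and has to be accepted.\<close>
      then obtain H' where H': "simple_graph H'" "isomorphic H H'" "edges ?F \<subseteq> edges H'"
        by (rule contains_copy_isomorphic_supergraph[OF simple[OF H] F(1)]) blast
      then have "H' \<in> P" using P H unfolding graph_property_def by blast
      moreover have "V \<in> views (q \<epsilon>) H'" using transfer[OF H'(1)] H'(3) by simp
      ultimately show False using accepted_views[OF T \<epsilon> H'(1)] rej by blast
    qed
    then show ?thesis using F0 F(2) unfolding contains_copy_def by blast
  qed
  then show ?thesis by blast
qed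

theorem theoremB1:
  fixes P :: "graph set"
  assumes "graph_property P"
    and "has_oblivious_one_sided_tester P"
  shows "uniformly_semi_subgraph_free P"
proof -
  obtain q decide where T: "oblivious_one_sided_tester P q decide"
    using assms(2) unfolding has_oblivious_one_sided_tester_def by blast
  obtain B :: "real \<Rightarrow> nat" where B: "\<And>\<epsilon> G. \<epsilon> \<in> {0<..<1} \<Longrightarrow> simple_graph G \<Longrightarrow> far_from \<epsilon> P G \<Longrightarrow>
    \<exists>F. simple_graph F \<and> verts F \<subseteq> {..<B \<epsilon>} \<and> (\<forall>H\<in>P. \<not> contains_copy H F) \<and> contains_copy G F"
    using forbidden_family[OF assms(1) T] by metis
  \<comment> \<open>Taking all graphs within the bound that no member of \<open>P\<close> contains
    makes the family depend on \<open>P\<close> and \<open>\<epsilon>\<close> alone.\<close>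
  define \<H> where "\<H> \<epsilon> = {F. (simple_graph F \<and> verts F \<subseteq> {..<B \<epsilon>}) \<and> (\<forall>H\<in>P. \<not> contains_copy H F)}" for \<epsilon>
  have "finite (\<H> \<epsilon>)" for \<epsilon>
    unfolding \<H>_def using finite_graphs_below by (rule rev_finite_subset) blast
  moreover have "card (verts F) \<le> B \<epsilon>" if "F \<in> \<H> \<epsilon>" for F \<epsilon>
    using that card_mono[of "{..<B \<epsilon>}" "verts F"] by (simp add: \<H>_def)
  moreover have "\<exists>F\<in>\<H> \<epsilon>. contains_copy G F"
    if "\<epsilon> \<in> {0<..<1}" "simple_graph G" "far_from \<epsilon> P G" for \<epsilon> G
    using B[OF that] by (auto simp: \<H>_def)
  \<comment> \<open>A single function has to bound both the number of members and their orders,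
    hence the sum of the two bounds.\<close>
  ultimately have "\<forall>\<epsilon>\<in>{0<..<1}. finite (\<H> \<epsilon>) \<and> card (\<H> \<epsilon>) \<le> B \<epsilon> + card (\<H> \<epsilon>) \<and>
      (\<forall>F\<in>\<H> \<epsilon>. simple_graph F \<and> card (verts F) \<le> B \<epsilon> + card (\<H> \<epsilon>)) \<and>
      (\<forall>G\<in>P. \<not> (\<exists>F\<in>\<H> \<epsilon>. contains_copy G F)) \<and>
      (\<forall>G. simple_graph G \<longrightarrow> far_from \<epsilon> P G \<longrightarrow> (\<exists>F\<in>\<H> \<epsilon>. contains_copy G F))"
    by (simp add: trans_le_add1) (simp add: \<H>_def)
  then show ?thesis
    unfolding uniformly_semi_subgraph_free_def
    by (intro exI[of _ "\<lambda>\<epsilon>. B \<epsilon> + card (\<H> \<epsilon>)"]) blast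
qed

end
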